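(* Let $G$ be a finite tree with at least two vertices. Then $D_3(G)$ is connected if and only if $G$ has two inner nodes whose distance is $3k+1$ or $3k+2$ for some integer $k\geqslant 0$.
   Context: The $3$-distance graph $D_3(G)$ has vertex set $V(G)$, two vertices being adjacent iff their distance in $G$ is exactly $3$. A vertex $u$ of a graph $G$ is an inner node if $\deg(u)\geqslant 3$ and $u$ has at least two neighbours of degree at least $2$. *)

theory Defs
  imports "Graph_Theory.Graph_Theory"
begin

text \<open>
  A simple graph is a \<^locale>\<open>pair_graph\<close>: a finite symmetric loop-free digraph whose arcs are
  ordered pairs, so that each undirected edge is the pair of arcs \<open>(u, v)\<close>, \<open>(v, u)\<close>. Neighbours of
  \<open>u\<close> are the \<open>v\<close> with \<open>(u, v) \<in> parcs G\<close> and the degree of \<open>u\<close> is \<open>out_degree G u\<close>.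
\<close>

text \<open>
  The library's \<open>tree\<close> and \<open>forest\<close> are meant for digraphs without antiparallel arcs: going back
  and forth along an edge is a directed cycle of length 2, so no symmetric digraph with an edge is
  a \<open>forest\<close>. In a simple graph the undirected cycles are exactly the directed cycles of
  length at least 3.
\<close>

definition graph_tree :: "'a pair_pre_digraph \<Rightarrow> bool" where
  "graph_tree G \<longleftrightarrow>
     pair_graph G \<and> connected (with_proj G) \<and>
     \<not> (\<exists>p. pre_digraph.cycle (with_proj G) p \<and> 3 \<le> length p)"

text \<open>
  Distance is the library's infimum of walk costs with all arc weights 1; it is \<open>\<infinity>\<close> for vertices
  in different components.
\<close>

definition graph_dist :: "'a pair_pre_digraph \<Rightarrow> 'a \<Rightarrow> 'a \<Rightarrow> ereal" where
  "graph_dist G u v = wf_digraph.\<mu> (with_proj G) (\<lambda>_. 1) u v"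

lemma graph_dist_eq_INF_length:
  assumes "pair_wf_digraph G"
  shows "graph_dist G u v = (INF p \<in> {p. pre_digraph.awalk (with_proj G) u p v}. ereal (length p))"
proof -
  interpret pair_wf_digraph G by fact
  show ?thesis
    by (simp add: graph_dist_def \<mu>_def awalk_cost_def sum_list_triv)
qed

definition three_distance_graph :: "'a pair_pre_digraph \<Rightarrow> 'a pair_pre_digraph" where
  "three_distance_graph G =
     \<lparr> pverts = pverts G,
       parcs = {(u, v). u \<in> pverts G \<and> v \<in> pverts G \<and> graph_dist G u v = 3} \<rparr>"

definition inner_node :: "'a pair_pre_digraph \<Rightarrow> 'a \<Rightarrow> bool" where
  "inner_node G u \<longleftrightarrow>
     u \<in> pverts G \<and> 3 \<le> out_degree (with_proj G) u \<and>
     2 \<le> card {v. (u, v) \<in> parcs G \<and> 2 \<le> out_degree (with_proj G) v}"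

end

theory Submission
  imports Defs
begin

text \<open>
  Fix an inner node \<open>w\<close> and colour each vertex by its distance from \<open>w\<close> modulo 3. The vertices of
  colour 0 lie in one component of the 3-distance graph, since a vertex is linked to its ancestor
  three levels up, and those of colour 1 or 2 also lie in one component, since neighbours of \<open>w\<close>
  are linked to the vertices at distance 2 in other branches. If \<open>u\<close> and \<open>v\<close> are inner nodes
  whose distance is not divisible by 3, some neighbour of \<open>u\<close> has nonzero colour for both of
  them, and this merges all classes.

  Conversely, root the tree at an inner node, or at any node of degree at least 2 if there is no
  inner node. Along a path of length 3 the depth changes by 3, or the path turns at a node of least
  depth that is the root or an inner node. If all inner nodes have depth divisible by 3, no path of
  the latter kind ends at depth divisible by 3, so these vertices form a union of components that
  does not contain the neighbours of the root.
\<close>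

locale tree_graph =
  fixes G :: "'a pair_pre_digraph"
  assumes graph_tree: "graph_tree G"

sublocale tree_graph \<subseteq> pair_graph G
  using graph_tree by (simp add: graph_tree_def)

lemma length_rev_path [simp]: "length (rev_path p) = length p"
  by (induction p) auto

lemma two_le_card_iff:
  assumes "finite A"
  shows "2 \<le> card A \<longleftrightarrow> (\<exists>x \<in> A. \<exists>y \<in> A. x \<noteq> y)"
  using card_le_Suc0_iff_eq[OF assms] by (simp add: numeral_2_eq_2 flip: not_less_eq_eq)

section \<open>Distance as the length of a shortest walk\<close>

context tree_graph
begin

text \<open>Distance as a natural number, so that induction and \<open>Suc\<close> arithmetic on
  levels apply. Between vertices a walk always exists by connectedness, so \<open>LEAST\<close> is
  attained. The first argument acts as the root.\<close>

definition depth :: "'a \<Rightarrow> 'a \<Rightarrow> nat" where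
  "depth r v = (LEAST n. \<exists>p. awalk r p v \<and> length p = n)"

lemma depth_le: "awalk r p v \<Longrightarrow> depth r v \<le> length p"
  unfolding depth_def by (rule Least_le) blast

lemma awalk_exists:
  assumes "u \<in> pverts G" "v \<in> pverts G"
  shows "\<exists>p. awalk u p v"
proof -
  have "connected (with_proj G)"
    using graph_tree by (simp add: graph_tree_def)
  then have "u \<rightarrow>\<^sup>*\<^bsub>mk_symmetric G\<^esub> v"
    using assms by (auto simp: connected_def strongly_connected_def)
  then show ?thesis
    using reachable_mk_symmetric_eq[OF sym_arcs] reachable_awalk by blast
qed

lemma shortest_awalk:
  assumes "u \<in> pverts G" "v \<in> pverts G"
  obtains p where "awalk u p v" "length p = depth u v"
proof -
  have "\<exists>n p. awalk u p v \<and> length p = n"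
    using awalk_exists[OF assms] by blast
  then have "\<exists>p. awalk u p v \<and> length p = depth u v"
    unfolding depth_def by (rule LeastI_ex)
  then show ?thesis using that by blast
qed

lemma graph_dist_eq_depth:
  assumes "u \<in> pverts G" "v \<in> pverts G"
  shows "graph_dist G u v = ereal (real (depth u v))"
proof -
  obtain p where p: "awalk u p v" "length p = depth u v"
    using shortest_awalk[OF assms] .
  have "(INF p \<in> {p. awalk u p v}. ereal (length p)) = ereal (real (depth u v))"
  proof (rule antisym)
    show "(INF p \<in> {p. awalk u p v}. ereal (length p)) \<le> ereal (real (depth u v))"
      using p by (intro INF_lower2[of p]) auto
    show "ereal (real (depth u v)) \<le> (INF p \<in> {p. awalk u p v}. ereal (length p))"
      by (intro INF_greatest) (auto dest: depth_le)
  qed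
  then show ?thesis
    by (simp add: graph_dist_eq_INF_length[OF pair_wf_digraph])
qed

lemma depth_eq_0_iff:
  assumes "u \<in> pverts G" "v \<in> pverts G"
  shows "depth u v = 0 \<longleftrightarrow> u = v"
proof
  assume "depth u v = 0"
  then show "u = v"
    using shortest_awalk[OF assms] by (metis awalk_empty_ends length_0_conv)
next
  assume "u = v"
  then show "depth u v = 0"
    using depth_le[of u "[]" v] assms by (simp add: awalk_Nil_iff)
qed

lemma depth_commute:
  assumes "u \<in> pverts G" "v \<in> pverts G"
  shows "depth u v = depth v u"
proof -
  have le: "depth x y \<le> depth y x" if xy: "x \<in> pverts G" "y \<in> pverts G" for x y
  proof -
    obtain p where p: "awalk y p x" "length p = depth y x"
      using shortest_awalk[OF xy(2,1)] .
    then show ?thesis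
      using depth_le[of x "rev_path p" y] by simp
  qed
  show ?thesis
    using le[OF assms] le[OF assms(2,1)] by simp
qed

section \<open>Levels of the tree seen from a root\<close>

lemma depth_arc_le:
  assumes "r \<in> pverts G" "(x, y) \<in> parcs G"
  shows "depth r y \<le> Suc (depth r x)"
proof -
  obtain p where p: "awalk r p x" "length p = depth r x"
    using shortest_awalk assms in_arcsD1 by metis
  have "awalk x [(x, y)] y"
    using assms arc_implies_awalk by fastforce
  then have "awalk r (p @ [(x, y)]) y"
    using p awalk_appendI by blast
  from depth_le[OF this] p show ?thesis
    by simp
qed

lemma parent_exists:
  assumes "r \<in> pverts G" "x \<in> pverts G" "depth r x = Suc n"
  obtains y where "(x, y) \<in> parcs G" "depth r y = n"
proof -
  obtain p where p: "awalk x p r" "length p = Suc n"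
    using shortest_awalk assms depth_commute by metis
  then obtain e q where [simp]: "p = e # q"
    by (cases p) auto
  define y where "y = snd e"
  have xy: "(x, y) \<in> parcs G" and q: "awalk y q r"
    using p by (auto simp: y_def awalk_Cons_iff)
  have "depth r y \<le> n"
    using depth_le[OF q] p depth_commute[OF assms(1) in_arcsD2[OF xy]] by simp
  moreover have "Suc n \<le> Suc (depth r y)"
    using depth_arc_le[OF assms(1) arcs_symmetric[OF xy]] assms by simp
  ultimately have "depth r y = n" by simp
  with xy show ?thesis using that by blast
qed

text \<open>Climb from both vertices to parents and join these by induction, or by the empty path if
  they coincide. The new endpoints lie on level \<open>Suc n\<close> and the old path on levels up
  to \<open>n\<close>, so the extension stays simple; the level bound is carried along for
  this.\<close>

lemma same_level_path:
  assumes "r \<in> pverts G" "x \<in> pverts G" "y \<in> pverts G"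
    and "depth r x = n" "depth r y = n" "x \<noteq> y"
  shows "\<exists>p. apath x p y \<and> 2 \<le> length p \<and> (\<forall>z \<in> set (awalk_verts x p). depth r z \<le> n)"
  using assms
proof (induction n arbitrary: x y)
  case 0
  then show ?case by (metis depth_eq_0_iff)
next
  case (Suc n)
  obtain a where a: "(x, a) \<in> parcs G" "depth r a = n"
    using parent_exists Suc.prems by metis
  obtain b where b: "(y, b) \<in> parcs G" "depth r b = n"
    using parent_exists Suc.prems by metis
  have ab: "a \<in> pverts G" "b \<in> pverts G"
    using a b in_arcsD2 by auto
  obtain p where p: "apath a p b" "\<forall>z \<in> set (awalk_verts a p). depth r z \<le> n"
  proof (cases "a = b")
    case True
    then show ?thesis
      using that[of "[]"] ab a by (auto simp: apath_Nil_iff)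
  next
    case False
    then show ?thesis
      using that Suc.IH[OF Suc.prems(1) ab a(2) b(2)] by blast
  qed
  \<comment> \<open>Paths grow at the front only: reverse, prepend \<open>y\<close>, reverse back,
    prepend \<open>x\<close>.\<close>
  let ?q = "(y, b) # rev_path p"
  have q_verts: "awalk_verts y ?q = y # rev (awalk_verts a p)"
    using p awalk_verts_rev_path[of a p b] by (simp add: apath_def)
  have "apath b (rev_path p) a"
    using p by simp
  moreover have "y \<notin> set (awalk_verts b (rev_path p))"
    using p Suc.prems awalk_verts_rev_path[of a p b] by (fastforce simp: apath_def)
  ultimately have q: "apath y ?q a"
    using b by (auto simp: apath_Cons_iff)
  let ?s = "(x, a) # rev_path ?q"
  have s_verts: "awalk_verts x ?s = x # awalk_verts a p @ [y]"
    using q q_verts awalk_verts_rev_path[of y ?q a] by (simp add: apath_def)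
  have "apath a (rev_path ?q) y"
    using q apath_rev_path by blast
  moreover have "x \<notin> set (awalk_verts a (rev_path ?q))"
    using p(2) Suc.prems s_verts by (fastforce simp: apath_def)
  ultimately have "apath x ?s y"
    using a by (auto simp: apath_Cons_iff)
  moreover have "\<forall>z \<in> set (awalk_verts x ?s). depth r z \<le> Suc n"
    unfolding s_verts using p(2) Suc.prems by auto
  ultimately show ?case
    by (intro exI[of _ ?s]) auto
qed

text \<open>The arc closes the path to a cycle of at least 3 arcs, which \<open>graph_tree\<close>
  excludes.\<close>

lemma no_cycle_from_path:
  assumes "apath x p y" "2 \<le> length p" "(y, x) \<in> parcs G"
  shows False
proof -
  have "awalk y ((y, x) # p) y"
    using assms by (simp add: apath_def awalk_Cons_iff)
  moreover have "distinct (tl (awalk_verts y ((y, x) # p)))"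
    using assms by (simp add: apath_def)
  ultimately have "cycle ((y, x) # p)"
    unfolding cycle_def by blast
  then show False
    using graph_tree assms unfolding graph_tree_def
    by (metis Suc_le_mono length_Cons numeral_2_eq_2 numeral_3_eq_3)
qed

text \<open>Levels of neighbours differ by at most 1. They cannot be equal, since the arc would
  close the path from \<open>same_level_path\<close> to a cycle.\<close>

lemma depth_arc_cases:
  assumes "r \<in> pverts G" "(x, y) \<in> parcs G"
  obtains "depth r y = Suc (depth r x)" | "depth r x = Suc (depth r y)"
proof -
  have "x \<noteq> y"
    using assms no_loops' by blast
  moreover have "depth r x \<noteq> depth r y"
  proof
    assume "depth r x = depth r y"
    then obtain p where "apath x p y" "2 \<le> length p"
      using same_level_path[OF assms(1), of x y] assms in_arcsD1 in_arcsD2 \<open>x \<noteq> y\<close> by metis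
    then show False
      using no_cycle_from_path arcs_symmetric assms by blast
  qed
  ultimately show ?thesis
    using depth_arc_le[OF assms] depth_arc_le[OF assms(1) arcs_symmetric[OF assms(2)]] that
    by linarith
qed

text \<open>Two parents of \<open>y\<close> would be joined by a path no deeper than they are. It
  misses \<open>y\<close>, so returning through \<open>y\<close> closes a cycle.\<close>

lemma parent_unique:
  assumes "r \<in> pverts G" "(x, y) \<in> parcs G" "(z, y) \<in> parcs G"
    and "depth r y = Suc (depth r x)" "depth r y = Suc (depth r z)"
  shows "x = z"
proof (rule ccontr)
  assume "x \<noteq> z"
  then obtain p where p: "apath x p z" "2 \<le> length p"
      "\<forall>v \<in> set (awalk_verts x p). depth r v \<le> depth r x"
    using same_level_path[OF assms(1), of x z "depth r x"] assms in_arcsD1 by auto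
  have "apath y ((y, x) # p) z"
    using p assms arcs_symmetric by (fastforce simp: apath_Cons_iff)
  then show False
    using no_cycle_from_path assms p by fastforce
qed

text \<open>Only the parent \<open>x\<close> of \<open>y\<close> is nearer to the root, so a walk
  that has started downwards and does not turn back keeps descending.\<close>

lemma depth_descend:
  assumes "r \<in> pverts G" "(x, y) \<in> parcs G" "(y, z) \<in> parcs G" "x \<noteq> z"
    and "depth r y = Suc (depth r x)"
  shows "depth r z = Suc (depth r y)"
  using assms(1,3)
proof (cases rule: depth_arc_cases)
  case 2
  then show ?thesis
    using parent_unique[OF assms(1,2) arcs_symmetric[OF assms(3)] assms(5)] assms(4) by simp
qed simp

section \<open>Distances one and three\<close>

lemma depth_arc:
  assumes "(x, y) \<in> parcs G"
  shows "depth x y = Suc 0"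
  using in_arcsD1[OF assms] assms
proof (cases rule: depth_arc_cases)
  case 1
  then show ?thesis
    using depth_eq_0_iff[of x x] in_arcsD1[OF assms] by simp
next
  case 2
  then show ?thesis
    using depth_eq_0_iff[of x x] in_arcsD1[OF assms] by simp
qed

text \<open>Root the tree at \<open>x\<close>: the first arc leads down, and
  \<open>depth_descend\<close> settles the other two.\<close>

lemma depth_three:
  assumes "(x, a) \<in> parcs G" "(a, b) \<in> parcs G" "(b, y) \<in> parcs G" "x \<noteq> b" "a \<noteq> y"
  shows "depth x y = 3"
proof -
  have x: "x \<in> pverts G" using assms in_arcsD1 by blast
  have "depth x b = Suc (depth x a)"
    using depth_descend[OF x assms(1,2,4)] depth_arc[OF assms(1)] depth_eq_0_iff[OF x x] by simp
  then show ?thesis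
    using depth_descend[OF x assms(2,3,5)] depth_arc[OF assms(1)] by simp
qed

lemma depth_threeE:
  assumes "x \<in> pverts G" "y \<in> pverts G" "depth x y = 3"
  obtains a b where "(x, a) \<in> parcs G" "(a, b) \<in> parcs G" "(b, y) \<in> parcs G" "x \<noteq> b" "a \<noteq> y"
proof -
  obtain b where b: "(y, b) \<in> parcs G" "depth x b = 2"
    by (rule parent_exists[OF assms(1,2), of 2]) (simp_all add: assms(3))
  obtain a where a: "(b, a) \<in> parcs G" "depth x a = 1"
    by (rule parent_exists[OF assms(1) in_arcsD2[OF b(1)], of 1]) (simp_all add: b(2))
  obtain c where c: "(a, c) \<in> parcs G" "depth x c = 0"
    by (rule parent_exists[OF assms(1) in_arcsD2[OF a(1)], of 0]) (simp_all add: a(2))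
  have "c = x"
    using c depth_eq_0_iff[OF assms(1) in_arcsD2[OF c(1)]] by simp
  moreover have "x \<noteq> b"
    using b(2) depth_eq_0_iff[OF assms(1,1)] by auto
  moreover have "a \<noteq> y"
    using a(2) assms(3) by auto
  ultimately show ?thesis
    using that[of a b] a(1) b(1) c(1) arcs_symmetric by blast
qed

section \<open>Degrees and inner nodes\<close>

lemma degree_conv: "out_degree (with_proj G) v = card {y. (v, y) \<in> parcs G}"
proof -
  have "out_arcs (with_proj G) v = Pair v ` {y. (v, y) \<in> parcs G}"
    by (auto simp: out_arcs_def)
  then show ?thesis
    by (simp add: out_degree_def card_image inj_on_def)
qed

lemma finite_neighbours [simp]: "finite {y. (v, y) \<in> parcs G \<and> P y}"
  by (rule finite_subset[OF _ pair_finite_verts]) (auto dest: in_arcsD2)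

lemma two_le_degree_iff:
  assumes "(v, w) \<in> parcs G"
  shows "2 \<le> out_degree (with_proj G) v \<longleftrightarrow> (\<exists>c. (v, c) \<in> parcs G \<and> c \<noteq> w)"
proof -
  have "finite {y. (v, y) \<in> parcs G}"
    using finite_neighbours[of v "\<lambda>_. True"] by simp
  then show ?thesis
    using assms unfolding degree_conv by (subst two_le_card_iff) auto
qed

text \<open>The degree conditions become explicit witnesses: \<open>c1\<close> and \<open>c2\<close>
  lie at distance 2 from \<open>w\<close> and serve as ends of paths of length 3 through
  \<open>w\<close>. The third neighbour \<open>a3\<close> may be a leaf.\<close>

lemma inner_node_iff:
  "inner_node G w \<longleftrightarrow> (\<exists>a1 a2 a3 c1 c2. distinct [a1, a2, a3] \<and>
     (w, a1) \<in> parcs G \<and> (w, a2) \<in> parcs G \<and> (w, a3) \<in> parcs G \<and>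
     (a1, c1) \<in> parcs G \<and> c1 \<noteq> w \<and> (a2, c2) \<in> parcs G \<and> c2 \<noteq> w)" (is "_ \<longleftrightarrow> ?R")
proof -
  let ?N = "{y. (w, y) \<in> parcs G}"
  let ?B = "{y. (w, y) \<in> parcs G \<and> 2 \<le> out_degree (with_proj G) y}"
  have fin: "finite ?N" "finite ?B"
    using finite_neighbours[of w "\<lambda>_. True"] by auto
  have mem_B: "y \<in> ?B \<longleftrightarrow> (w, y) \<in> parcs G \<and> (\<exists>c. (y, c) \<in> parcs G \<and> c \<noteq> w)" for y
    using two_le_degree_iff[of y w] arcs_symmetric[of w y] by blast
  have two: "2 \<le> card ?B \<longleftrightarrow> (\<exists>a1 a2. a1 \<in> ?B \<and> a2 \<in> ?B \<and> a1 \<noteq> a2)"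
    unfolding two_le_card_iff[OF fin(2)] by blast
  show ?thesis
  proof
    assume w: "inner_node G w"
    then obtain a1 a2 where a: "a1 \<in> ?B" "a2 \<in> ?B" "a1 \<noteq> a2"
      using two unfolding inner_node_def by blast
    have "3 \<le> card ?N"
      using w by (simp add: inner_node_def degree_conv)
    moreover have "card ?N \<le> 2" if "?N \<subseteq> {a1, a2}"
      using card_mono[OF _ that] a by simp
    ultimately obtain a3 where "(w, a3) \<in> parcs G" "a3 \<noteq> a1" "a3 \<noteq> a2"
      by fastforce
    moreover obtain c1 c2 where "(a1, c1) \<in> parcs G" "c1 \<noteq> w" "(a2, c2) \<in> parcs G" "c2 \<noteq> w"
      using a(1,2) unfolding mem_B by blast
    ultimately show ?R
      using a by (intro exI[of _ a1] exI[of _ a2] exI[of _ a3] exI[of _ c1] exI[of _ c2]) auto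
  next
    assume ?R
    then obtain a1 a2 a3 c1 c2 where a: "distinct [a1, a2, a3]"
        "(w, a1) \<in> parcs G" "(w, a2) \<in> parcs G" "(w, a3) \<in> parcs G"
        "(a1, c1) \<in> parcs G" "c1 \<noteq> w" "(a2, c2) \<in> parcs G" "c2 \<noteq> w"
      by (elim exE conjE)
    then have *: "distinct [a1, a2, a3]" "{a1, a2, a3} \<subseteq> ?N" "a1 \<in> ?B" "a2 \<in> ?B"
      unfolding mem_B by blast+
    have "3 \<le> card ?N"
      using card_mono[OF fin(1) *(2)] *(1) by simp
    moreover have "2 \<le> card ?B"
      using two *(1,3,4) unfolding distinct_length_2_or_more by blast
    ultimately show "inner_node G w"
      using in_arcsD1[OF a(2)] by (simp add: inner_node_def degree_conv)
  qed
qed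

section \<open>Reachability in the 3-distance graph\<close>

abbreviation far :: "'a rel" where
  "far \<equiv> parcs (three_distance_graph G)"

lemma far_iff: "(x, y) \<in> far \<longleftrightarrow> x \<in> pverts G \<and> y \<in> pverts G \<and> depth x y = 3"
  by (auto simp: three_distance_graph_def graph_dist_eq_depth)

lemma sym_far: "sym far"
  using depth_commute by (auto simp: sym_def far_iff)

lemma rtrancl_far_commute: "(x, y) \<in> far\<^sup>* \<Longrightarrow> (y, x) \<in> far\<^sup>*"
  using sym_rtrancl[OF sym_far] by (rule symD)

text \<open>As \<open>far\<close> is symmetric and relates vertices only, neither the symmetric
  closure nor the restriction to vertices in the library notion changes reachability.\<close>

lemma connected_far_iff:
  "connected (with_proj (three_distance_graph G)) \<longleftrightarrow>
     pverts G \<noteq> {} \<and> (\<forall>u \<in> pverts G. \<forall>v \<in> pverts G. (u, v) \<in> far\<^sup>*)"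
proof -
  have 1: "parcs (mk_symmetric (with_proj (three_distance_graph G))) = far"
    using sym_far by (force simp: parcs_mk_symmetric sym_def)
  have 2: "(u, v) \<in> rtrancl_on (pverts G) far \<longleftrightarrow> (u, v) \<in> far\<^sup>*"
    if "u \<in> pverts G" for u v
  proof
    show "(u, v) \<in> far\<^sup>*" if "(u, v) \<in> rtrancl_on (pverts G) far"
      using that by (induction rule: rtrancl_on_induct) auto
    show "(u, v) \<in> rtrancl_on (pverts G) far" if "(u, v) \<in> far\<^sup>*"
      using that
    proof (induction rule: rtrancl_induct)
      case base
      then show ?case using \<open>u \<in> pverts G\<close> by simp
    next
      case (step y z)
      then show ?case
        by (meson far_iff rtrancl_on_into_rtrancl_on)
    qed
  qed
  have "pverts (three_distance_graph G) = pverts G"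
    by (simp add: three_distance_graph_def)
  then show ?thesis
    using 2 by (auto simp: connected_def strongly_connected_def reachable_def 1)
qed

text \<open>Climbing three levels is one \<open>far\<close> arc and keeps the residue; strong
  induction on the depth ends on level 0, 1 or 2.\<close>

lemma far_ancestor:
  assumes "r \<in> pverts G" "x \<in> pverts G"
  shows "\<exists>y \<in> pverts G. depth r y = depth r x mod 3 \<and> (x, y) \<in> far\<^sup>*"
  using assms(2)
proof (induction "depth r x" arbitrary: x rule: less_induct)
  case less
  show ?case
  proof (cases "depth r x < 3")
    case True
    then show ?thesis using less.prems by auto
  next
    case False
    then obtain n where n: "depth r x = Suc (Suc (Suc n))"
      using that[of "depth r x - 3"] by simp
    obtain a where a: "(x, a) \<in> parcs G" "depth r a = Suc (Suc n)"
      using parent_exists[OF assms(1) less.prems n] .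
    obtain b where b: "(a, b) \<in> parcs G" "depth r b = Suc n"
      using parent_exists[OF assms(1) in_arcsD2[OF a(1)] a(2)] .
    obtain c where c: "(b, c) \<in> parcs G" "depth r c = n"
      using parent_exists[OF assms(1) in_arcsD2[OF b(1)] b(2)] .
    have "depth x c = 3"
      using n a(2) b(2) c(2) by (intro depth_three[OF a(1) b(1) c(1)]) auto
    then have xc: "(x, c) \<in> far" and "c \<in> pverts G"
      using less.prems in_arcsD2[OF c(1)] by (auto simp: far_iff)
    then obtain y where "y \<in> pverts G" "depth r y = depth r c mod 3" "(c, y) \<in> far\<^sup>*"
      using less.hyps[of c] n c(2) by auto
    moreover have "depth r x = depth r c + 3"
      using n c(2) by simp
    then have "depth r x mod 3 = depth r c mod 3"
      by simp
    ultimately show ?thesis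
      using converse_rtrancl_into_rtrancl[OF xc] by auto
  qed
qed

lemma far_root:
  assumes "r \<in> pverts G" "x \<in> pverts G" "depth r x mod 3 = 0"
  shows "(x, r) \<in> far\<^sup>*"
  using far_ancestor[OF assms(1,2)] assms depth_eq_0_iff by auto

text \<open>The neighbour \<open>a3\<close> of \<open>w\<close> serves as a hub: levels 1 and 2 are
  linked to it first, then the deeper levels of nonzero residue through
  \<open>far_ancestor\<close>.\<close>

lemma far_inner:
  assumes w: "inner_node G w"
    and "x \<in> pverts G" "depth w x mod 3 \<noteq> 0" "y \<in> pverts G" "depth w y mod 3 \<noteq> 0"
  shows "(x, y) \<in> far\<^sup>*"
proof -
  have wV: "w \<in> pverts G"
    using w by (simp add: inner_node_def)
  obtain a1 a2 a3 c1 c2 where a: "a1 \<noteq> a2" "a1 \<noteq> a3" "a2 \<noteq> a3"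
      "(w, a1) \<in> parcs G" "(w, a2) \<in> parcs G" "(w, a3) \<in> parcs G"
    and c: "(a1, c1) \<in> parcs G" "c1 \<noteq> w" "(a2, c2) \<in> parcs G" "c2 \<noteq> w"
    using w unfolding inner_node_iff by auto
  \<comment> \<open>The path runs through \<open>c\<close>, \<open>a\<close>, \<open>w\<close>,
    \<open>b\<close>.\<close>
  have cousins: "(c, b) \<in> far\<^sup>*" "(b, c) \<in> far\<^sup>*"
    if "(w, a) \<in> parcs G" "(a, c) \<in> parcs G" "c \<noteq> w" "(w, b) \<in> parcs G" "b \<noteq> a" for a b c
  proof -
    have "depth c b = 3"
      using that arcs_symmetric by (intro depth_three[of c a w b]) auto
    then show "(c, b) \<in> far\<^sup>*"
      using that in_arcsD2 by (intro r_into_rtrancl) (auto simp: far_iff)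
    then show "(b, c) \<in> far\<^sup>*"
      by (rule rtrancl_far_commute)
  qed
  \<comment> \<open>Pass through a level 2 vertex below a neighbour other than \<open>b\<close> and
    \<open>a3\<close>: \<open>c2\<close> if \<open>b\<close> is \<open>a1\<close>, otherwise
    \<open>c1\<close>.\<close>
  have nbr: "(b, a3) \<in> far\<^sup>*" if b: "(w, b) \<in> parcs G" for b
  proof (cases "b = a1")
    case True
    have "(b, c2) \<in> far\<^sup>*" "(c2, a3) \<in> far\<^sup>*"
      using cousins[OF a(5) c(3,4)] a b True by auto
    then show ?thesis by (rule rtrancl_trans)
  next
    case False
    have "(b, c1) \<in> far\<^sup>*" "(c1, a3) \<in> far\<^sup>*"
      using cousins[OF a(4) c(1,2)] a b False by auto
    then show ?thesis by (rule rtrancl_trans)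
  qed
  have near: "(z, a3) \<in> far\<^sup>*" if z: "z \<in> pverts G" "depth w z = 1 \<or> depth w z = 2" for z
    using z(2)
  proof
    assume "depth w z = 1"
    then obtain b where "(z, b) \<in> parcs G" "depth w b = 0"
      using parent_exists[OF wV z(1), of 0] by auto
    then have "(w, z) \<in> parcs G"
      using depth_eq_0_iff[OF wV] in_arcsD2 arcs_symmetric by blast
    then show ?thesis by (rule nbr)
  next
    assume dz: "depth w z = 2"
    then obtain p where p: "(z, p) \<in> parcs G" "depth w p = Suc 0"
      using parent_exists[OF wV z(1), of 1] by auto
    obtain b where b: "(p, b) \<in> parcs G" "depth w b = 0"
      using parent_exists[OF wV in_arcsD2[OF p(1)] p(2)] .
    have wp: "(w, p) \<in> parcs G"
      using b depth_eq_0_iff[OF wV] in_arcsD2 arcs_symmetric by blast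
    have zw: "z \<noteq> w"
      using dz depth_eq_0_iff[OF wV wV] by auto
    show ?thesis
    proof (cases "p = a3")
      case True
      \<comment> \<open>A child of \<open>a3\<close> is not at distance 3 from \<open>a3\<close>, so
        it makes a detour through \<open>a1\<close>.\<close>
      then have "(z, a1) \<in> far\<^sup>*"
        using cousins(1)[OF wp arcs_symmetric[OF p(1)] zw a(4)] a by simp
      then show ?thesis
        using nbr[OF a(4)] by (rule rtrancl_trans)
    next
      case False
      then show ?thesis
        using cousins(1)[OF wp arcs_symmetric[OF p(1)] zw a(6)] by simp
    qed
  qed
  have hub: "(z, a3) \<in> far\<^sup>*" if z: "z \<in> pverts G" "depth w z mod 3 \<noteq> 0" for z
  proof -
    obtain z' where z': "z' \<in> pverts G" "depth w z' = depth w z mod 3" "(z, z') \<in> far\<^sup>*"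
      using far_ancestor[OF wV z(1)] by blast
    have "depth w z' = 1 \<or> depth w z' = 2"
      using z z' by linarith
    then show ?thesis
      using near z' by (meson rtrancl_trans)
  qed
  show ?thesis
    using hub assms rtrancl_far_commute by (meson rtrancl_trans)
qed

section \<open>Connectedness from two inner nodes\<close>

lemma inner_child:
  assumes "r \<in> pverts G" "inner_node G w"
  obtains y where "(w, y) \<in> parcs G" "depth r y = Suc (depth r w)"
proof -
  obtain a b where ab: "a \<noteq> b" "(w, a) \<in> parcs G" "(w, b) \<in> parcs G"
    using assms(2) unfolding inner_node_iff by auto
  \<comment> \<open>At most one of the two neighbours is the parent of \<open>w\<close>.\<close>
  have "depth r a = Suc (depth r w) \<or> depth r b = Suc (depth r w)"
    using depth_arc_cases[OF assms(1) ab(2)] depth_arc_cases[OF assms(1) ab(3)]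
      parent_unique[OF assms(1) arcs_symmetric[OF ab(2)] arcs_symmetric[OF ab(3)]] ab(1)
    by metis
  then show ?thesis using ab that by blast
qed

text \<open>The vertices of nonzero residue from \<open>u\<close> and those of nonzero residue from
  \<open>v\<close> share a neighbour \<open>y\<close> of \<open>u\<close>, and every vertex reaches
  this \<open>y\<close>.\<close>

lemma connected_far_if_inner_nodes:
  assumes u: "inner_node G u" and v: "inner_node G v" and uv: "depth v u mod 3 \<noteq> 0"
    and x: "x \<in> pverts G" and z: "z \<in> pverts G"
  shows "(x, z) \<in> far\<^sup>*"
proof -
  have V: "u \<in> pverts G" "v \<in> pverts G"
    using u v by (auto simp: inner_node_def)
  \<comment> \<open>From residue 1 step away from \<open>v\<close>, reaching residue 2; from residue
    2 step towards \<open>v\<close>, reaching residue 1.\<close>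
  obtain y where uy: "(u, y) \<in> parcs G" and vy: "depth v y mod 3 \<noteq> 0"
  proof (cases "depth v u mod 3 = 1")
    case True
    obtain y where "(u, y) \<in> parcs G" "depth v y = Suc (depth v u)"
      using inner_child[OF V(2) u] .
    then show ?thesis using that True by (simp add: mod_Suc)
  next
    case False
    then have d: "depth v u mod 3 = 2" using uv by linarith
    then obtain n where n: "depth v u = Suc n"
      by (cases "depth v u") auto
    obtain y where "(u, y) \<in> parcs G" "depth v y = n"
      using parent_exists[OF V(2,1) n] .
    then show ?thesis using that d n by (simp add: mod_Suc split: if_splits)
  qed
  have y: "y \<in> pverts G" "depth u y mod 3 \<noteq> 0"
    using in_arcsD2[OF uy] depth_arc[OF uy] by auto
  have *: "(t, y) \<in> far\<^sup>*" if t: "t \<in> pverts G" for t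
  proof -
    consider "depth u t mod 3 \<noteq> 0" | "depth v t mod 3 \<noteq> 0" | "depth u t mod 3 = 0"
      by blast
    then show ?thesis
    proof cases
      case 1
      then show ?thesis using far_inner[OF u t _ y] by simp
    next
      case 2
      then show ?thesis using far_inner[OF v t _ y(1) vy] by simp
    next
      case 3
      \<comment> \<open>The bridge is \<open>u\<close>: its residue is 0 from itself but nonzero
        from \<open>v\<close>.\<close>
      have "(t, u) \<in> far\<^sup>*"
        using far_root[OF V(1) t 3] .
      also have "(u, y) \<in> far\<^sup>*"
        using far_inner[OF v V(1) uv y(1) vy] .
      finally show ?thesis .
    qed
  qed
  show ?thesis
    using *[OF x] rtrancl_far_commute[OF *[OF z]] by (rule rtrancl_trans)
qed

section \<open>Turning points of paths and the converse\<close>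

lemma inner_node_if_two_children:
  assumes r: "r \<in> pverts G" "(r, s) \<in> parcs G" "(r, t) \<in> parcs G" "s \<noteq> t"
    and w: "(w, a) \<in> parcs G" "(w, b) \<in> parcs G" "a \<noteq> b"
    and d: "depth r a = Suc (depth r w)" "depth r b = Suc (depth r w)"
    and c: "(a, c) \<in> parcs G" "c \<noteq> w"
    and "w \<noteq> r"
  shows "inner_node G w"
proof -
  have wV: "w \<in> pverts G" using in_arcsD1[OF w(1)] .
  obtain n where n: "depth r w = Suc n"
    using \<open>w \<noteq> r\<close> depth_eq_0_iff[OF r(1) wV] by (cases "depth r w") auto
  obtain p where p: "(w, p) \<in> parcs G" "depth r p = n"
    using parent_exists[OF r(1) wV n] .
  have pV: "p \<in> pverts G" using in_arcsD2[OF p(1)] .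
  \<comment> \<open>Both \<open>a\<close> and the parent \<open>p\<close> are to have a neighbour
    besides \<open>w\<close>. For \<open>p\<close> it is the parent of \<open>p\<close>, or, if
    \<open>p\<close> is the root, whichever of \<open>s\<close> and \<open>t\<close> differs from
    \<open>w\<close>.\<close>
  obtain q where q: "(p, q) \<in> parcs G" "q \<noteq> w"
  proof (cases "p = r")
    case True
    then show ?thesis using r that by metis
  next
    case False
    then obtain m where m: "depth r p = Suc m"
      using depth_eq_0_iff[OF r(1) pV] by (cases "depth r p") auto
    obtain q where "(p, q) \<in> parcs G" "depth r q = m"
      using parent_exists[OF r(1) pV m] .
    moreover from this have "q \<noteq> w" using n p m by auto
    ultimately show ?thesis using that by blast
  qed
  have "distinct [a, p, b]"
    using w d n p by auto
  then show ?thesis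
    unfolding inner_node_iff using w p c q by blast
qed

text \<open>The three arcs first go up, then down. If all go the same way, the depth changes by 3.
  Otherwise the path turns at \<open>a\<close> or \<open>b\<close>, which lies 1 or 2 levels above
  \<open>x\<close>, whereas turning points have residue 0.\<close>

lemma far_preserves_depth_mod_three:
  assumes r: "r \<in> pverts G" "(r, s) \<in> parcs G" "(r, t) \<in> parcs G" "s \<noteq> t"
    and inner: "\<And>w. inner_node G w \<Longrightarrow> depth r w mod 3 = 0"
    and "(x, y) \<in> far" "depth r x mod 3 = 0"
  shows "depth r y mod 3 = 0"
proof -
  obtain a b where p: "(x, a) \<in> parcs G" "(a, b) \<in> parcs G" "(b, y) \<in> parcs G" "x \<noteq> b" "a \<noteq> y"
    using assms(6) depth_threeE unfolding far_iff by blast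
  \<comment> \<open>A vertex with two children, one of which has a further neighbour, is the root or
    an inner node.\<close>
  have peak: "depth r w mod 3 = 0"
    if "(w, a) \<in> parcs G" "(w, b) \<in> parcs G" "a \<noteq> b"
      "depth r a = Suc (depth r w)" "depth r b = Suc (depth r w)"
      "(a, c) \<in> parcs G" "c \<noteq> w" for w a b c
    using inner_node_if_two_children[OF r that] inner depth_eq_0_iff[OF r(1) r(1)]
    by (cases "w = r") auto
  show ?thesis
    using r(1) p(1)
  proof (cases rule: depth_arc_cases)
    case 1
    then have "depth r b = Suc (depth r a)"
      using depth_descend[OF r(1) p(1,2,4)] by simp
    moreover from this have "depth r y = Suc (depth r b)"
      using depth_descend[OF r(1) p(2,3,5)] by simp
    ultimately show ?thesis
      using 1 assms(7) by (simp add: mod_Suc)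
  next
    case xa: 2
    show ?thesis
      using r(1) p(2)
    proof (cases rule: depth_arc_cases)
      case 1
      have "depth r a mod 3 = 0"
        using peak[OF p(2) arcs_symmetric[OF p(1)] _ _ _ p(3)] p(4,5) 1 xa by auto
      then show ?thesis
        using xa assms(7) by (simp add: mod_Suc)
    next
      case ab: 2
      show ?thesis
        using r(1) p(3)
      proof (cases rule: depth_arc_cases)
        case 1
        have "depth r b mod 3 = 0"
          using peak[OF arcs_symmetric[OF p(2)] p(3) _ _ _ arcs_symmetric[OF p(1)]] p(4,5) 1 ab
          by auto
        then show ?thesis
          using xa ab assms(7) by (simp add: mod_Suc)
      next
        case 2
        then show ?thesis
          using xa ab assms(7) by (simp add: mod_Suc split: if_splits)
      qed
    qed
  qed
qed

text \<open>Without such a pair, residue 0 from a suitable root would be closed under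
  \<open>far\<close>, yet the neighbours of the root have depth 1.\<close>

lemma inner_nodes_if_connected_far:
  assumes conn: "\<And>x y. x \<in> pverts G \<Longrightarrow> y \<in> pverts G \<Longrightarrow> (x, y) \<in> far\<^sup>*"
    and "2 \<le> card (pverts G)"
  shows "\<exists>u v. inner_node G u \<and> inner_node G v \<and> depth u v mod 3 \<noteq> 0"
proof (rule ccontr)
  assume *: "\<not> ?thesis"
  \<comment> \<open>Any inner node serves as root, as the negated claim puts all inner nodes at
    residue 0 from it. If there is none, \<open>inner\<close> is vacuous.\<close>
  obtain r s t where r: "r \<in> pverts G" "(r, s) \<in> parcs G" "(r, t) \<in> parcs G" "s \<noteq> t"
    and inner: "\<And>w. inner_node G w \<Longrightarrow> depth r w mod 3 = 0"
  proof (cases "\<exists>w. inner_node G w")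
    case True
    then obtain r where ri: "inner_node G r" by blast
    then obtain s t where "(r, s) \<in> parcs G" "(r, t) \<in> parcs G" "s \<noteq> t"
      unfolding inner_node_iff by auto
    then show ?thesis
      using that[of r s t] ri * in_arcsD1 by blast
  next
    case False
    obtain x y where "x \<in> pverts G" "y \<in> pverts G" "x \<noteq> y"
      using assms(2) two_le_card_iff[OF pair_finite_verts] by auto
    \<comment> \<open>A nontrivial \<open>far\<close> walk leaves \<open>x\<close> by some arc; the
      second vertex \<open>a\<close> of the path behind that arc has the two neighbours
      \<open>x\<close> and \<open>b\<close>, so it can be the root.\<close>
    then obtain z where "(x, z) \<in> far"
      using conn[of x y] by (metis converse_rtranclE)
    then obtain a b where "(x, a) \<in> parcs G" "(a, b) \<in> parcs G" "x \<noteq> b"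
      using depth_threeE unfolding far_iff by blast
    then show ?thesis
      using that[of a x b] False in_arcsD1 arcs_symmetric by blast
  qed
  have "(r, s) \<in> far\<^sup>*"
    using conn r(1) in_arcsD2[OF r(2)] by blast
  then have "depth r s mod 3 = 0"
  proof (induction rule: rtrancl_induct)
    case base
    then show ?case using depth_eq_0_iff[OF r(1) r(1)] by simp
  next
    case (step y z)
    then show ?case using far_preserves_depth_mod_three[OF r _ step.hyps(2) step.IH] inner by blast
  qed
  then show False
    using depth_arc[OF r(2)] by simp
qed

end

section \<open>From residues of \<open>depth\<close> to the stated distances\<close>

theorem theorem2p7:
  fixes G :: "'a pair_pre_digraph"
  assumes "graph_tree G"
    and "2 \<le> card (pverts G)"
  shows "connected (with_proj (three_distance_graph G)) \<longleftrightarrow>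
    (\<exists>u v. inner_node G u \<and> inner_node G v \<and>
      (\<exists>k::nat. graph_dist G u v = ereal (real (3 * k + 1)) \<or>
                graph_dist G u v = ereal (real (3 * k + 2))))"
proof -
  interpret tree_graph G
    using assms(1) by unfold_locales
  have dist: "(\<exists>k::nat. graph_dist G u v = ereal (real (3 * k + 1)) \<or>
                graph_dist G u v = ereal (real (3 * k + 2))) \<longleftrightarrow> depth u v mod 3 \<noteq> 0"
    if "inner_node G u" "inner_node G v" for u v
  proof -
    have "graph_dist G u v = ereal (real n) \<longleftrightarrow> depth u v = n" for n
      using that by (simp add: inner_node_def graph_dist_eq_depth)
    moreover have "(\<exists>k. d = 3 * k + 1 \<or> d = 3 * k + 2) \<longleftrightarrow> d mod 3 \<noteq> 0" for d :: nat
      by presburger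
    ultimately show ?thesis by presburger
  qed
  have "(\<forall>x \<in> pverts G. \<forall>y \<in> pverts G. (x, y) \<in> far\<^sup>*) \<longleftrightarrow>
      (\<exists>u v. inner_node G u \<and> inner_node G v \<and> depth u v mod 3 \<noteq> 0)"
    using inner_nodes_if_connected_far[OF _ assms(2)] connected_far_if_inner_nodes by blast
  moreover have "pverts G \<noteq> {}"
    using assms(2) by auto
  ultimately show ?thesis
    unfolding connected_far_iff using dist by blast
qed

end
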